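(* Let $t\le k$ be positive integers and $n,s\ge0$ integers. The number of words $\pi\in[k]^n$ with $\mathrm{lev}_{[t]}(\pi)=s$ (i.e., with exactly $s$ levels whose first element lies in $[t]$) equals $$\sum_{m=0}^n\sum_{i=0}^m(-1)^{n-m-s}\binom{m}{i}\binom{i+n-m-1}{n-m}\binom{n-m}{s}(k-t)^{m-i}t^i.$$
   Context: $[k]=\{1,\ldots,k\}$, $[k]^n$ is the set of words of length $n$ over $[k]$. For a word $\pi=\pi_1\cdots\pi_n$ and $X\subseteq\mathbb{N}$, $\mathrm{lev}_X(\pi)=|\{i:\pi_i=\pi_{i+1},\ \pi_i\in X\}|$. Conventions: $\binom{a}{b}=\frac{a(a-1)\cdots(a-b+1)}{b!}$ for integers $b\ge0$ (so $\binom{-1}{0}=1$), $\binom{a}{b}=0$ for $b<0$, and $0^0=1$. *)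

theory Defs
  imports Complex_Main
begin

definition words :: "nat \<Rightarrow> nat \<Rightarrow> nat list set" where
  "words k n = {w. length w = n \<and> set w \<subseteq> {1..k}}"

text \<open>List positions are counted from 0.\<close>

definition lev :: "nat set \<Rightarrow> nat list \<Rightarrow> nat" where
  "lev X w = card {i. i + 1 < length w \<and> w ! i = w ! (i + 1) \<and> w ! i \<in> X}"

end

theory Submission
  imports
    Defs
    "HOL-Computational_Algebra.Formal_Power_Series"
    "HOL-Computational_Algebra.Polynomial"
begin

text \<open>
  Weight a word \<open>w\<close> by \<open>q ^ lev X w\<close>, where \<open>X = {1..t}\<close>, and put \<open>y = q - 1\<close>. Writing the
  weight of each level as \<open>1 + y\<close> amounts to marking a subset of the levels with weight \<open>y\<close>. A word
  with marked levels is a sequence of blocks, each of which is either a single letter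
  outside \<open>X\<close> or a run of a letter of \<open>X\<close> all of whose levels are marked. So the generating
  function in the length \<open>x\<close> is \<open>1 / (1 - x * u)\<close> with \<open>u = k - t + t / (1 - y * x)\<close>.
  Expanding \<open>u ^ m\<close> by the binomial theorem, and then \<open>y ^ (n - m) = (q - 1) ^ (n - m)\<close> in powers
  of \<open>q\<close>, gives the formula: the number of words with \<open>s\<close> levels is the coefficient of \<open>q ^ s\<close>
  when \<open>q\<close> is the variable of a polynomial ring. The block decomposition is verified through
  linear equations relating the generating function of all words to that of the words
  starting in \<open>X\<close>.
\<close>

unbundle fps_syntax

lemma lev_Nil [simp]: "lev X [] = 0"
  by (simp add: lev_def)

lemma lev_Cons:
  "lev X (c # w) = (if w \<noteq> [] \<and> hd w = c \<and> c \<in> X then 1 else 0) + lev X w"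
proof -
  let ?levels = "\<lambda>w. {i. i + 1 < length w \<and> w ! i = w ! (i + 1) \<and> w ! i \<in> X}"
  let ?first = "if w \<noteq> [] \<and> hd w = c \<and> c \<in> X then {0} else ({} :: nat set)"
  have "?levels (c # w) = ?first \<union> Suc ` ?levels w"
  proof (rule set_eqI)
    fix i show "i \<in> ?levels (c # w) \<longleftrightarrow> i \<in> ?first \<union> Suc ` ?levels w"
      by (cases i) (auto simp: hd_conv_nth)
  qed
  moreover have "finite (?levels w)" by (rule finite_subset[of _ "{..<length w}"]) auto
  ultimately show ?thesis
    unfolding lev_def by (simp add: card_image card_Un_disjoint)
qed

lemma finite_words [simp]: "finite (words k n)"
  using finite_lists_length_eq[of "{1..k}" n] by (simp add: words_def conj_commute)

lemma words_0 [simp]: "words k 0 = {[]}"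
  by (auto simp: words_def)

lemma sum_words_Suc_hd_in:
  assumes "C \<subseteq> {1..k}"
  shows "(\<Sum>w | w \<in> words k (Suc n) \<and> hd w \<in> C. f w) = (\<Sum>w\<in>words k n. \<Sum>c\<in>C. f (c # w))"
proof -
  have "{w \<in> words k (Suc n). hd w \<in> C} = (\<lambda>(w, c). c # w) ` (words k n \<times> C)"
    using assms by (force simp: words_def length_Suc_conv)
  moreover have "inj_on (\<lambda>(w, c). c # w) (words k n \<times> C)"
    by (auto simp: inj_on_def)
  ultimately show ?thesis
    by (simp add: sum.reindex sum.cartesian_product case_prod_unfold)
qed

lemma sum_power_lev_Cons_in:
  fixes q :: "'a :: comm_ring_1"
  assumes "finite X"
  shows "(\<Sum>c\<in>X. q ^ lev X (c # w)) =
    of_nat (card X) * q ^ lev X w + (q - 1) * (if w \<noteq> [] \<and> hd w \<in> X then q ^ lev X w else 0)"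
proof -
  have "q ^ lev X (c # w) =
      q ^ lev X w + (if c = hd w then if w \<noteq> [] then (q - 1) * q ^ lev X w else 0 else 0)"
    if "c \<in> X" for c
    using that by (simp add: lev_Cons algebra_simps)
  then show ?thesis
    using assms by (simp add: sum.distrib)
qed

definition lev_fps :: "nat set \<Rightarrow> nat \<Rightarrow> 'a \<Rightarrow> 'a :: comm_ring_1 fps" where
  "lev_fps X k q = Abs_fps (\<lambda>n. \<Sum>w\<in>words k n. q ^ lev X w)"

definition lev_hd_fps :: "nat set \<Rightarrow> nat \<Rightarrow> 'a \<Rightarrow> 'a :: comm_ring_1 fps" where
  "lev_hd_fps X k q = Abs_fps (\<lambda>n. \<Sum>w | w \<in> words k n \<and> w \<noteq> [] \<and> hd w \<in> X. q ^ lev X w)"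

lemma lev_fps_nth_0 [simp]: "lev_fps X k q $ 0 = 1" "lev_hd_fps X k q $ 0 = 0"
  by (simp_all add: lev_fps_def lev_hd_fps_def cong: conj_cong)

lemma lev_hd_fps_nth_Suc:
  "lev_hd_fps X k q $ Suc n = (\<Sum>w | w \<in> words k (Suc n) \<and> hd w \<in> X. q ^ lev X w)"
proof -
  have "{w \<in> words k (Suc n). w \<noteq> [] \<and> hd w \<in> X} = {w \<in> words k (Suc n). hd w \<in> X}"
    by (auto simp: words_def)
  then show ?thesis by (simp add: lev_hd_fps_def)
qed

lemma lev_hd_fps_eq:
  assumes "X \<subseteq> {1..k}"
  shows "lev_hd_fps X k q =
    fps_X * (of_nat (card X) * lev_fps X k q + fps_const (q - 1) * lev_hd_fps X k q)"
    (is "_ = ?rhs")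
proof (rule fps_ext)
  have "finite X" using assms finite_subset by blast
  fix n show "lev_hd_fps X k q $ n = ?rhs $ n"
  proof (cases n)
    case 0
    then show ?thesis by simp
  next
    case (Suc l)
    have "lev_hd_fps X k q $ n = (\<Sum>w\<in>words k l. \<Sum>c\<in>X. q ^ lev X (c # w))"
      using assms by (simp add: Suc lev_hd_fps_nth_Suc sum_words_Suc_hd_in)
    also have "\<dots> = of_nat (card X) * lev_fps X k q $ l + (q - 1) * lev_hd_fps X k q $ l"
      using \<open>finite X\<close> by (simp add: sum_power_lev_Cons_in sum.distrib sum.inter_filter
          lev_fps_def lev_hd_fps_def flip: sum_distrib_left)
    finally show ?thesis by (simp add: Suc)
  qed
qed

lemma lev_fps_eq:
  assumes "X \<subseteq> {1..k}"
  shows "lev_fps X k q =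
    1 + fps_X * (of_nat (k - card X) * lev_fps X k q) + lev_hd_fps X k q" (is "_ = ?rhs")
proof (rule fps_ext)
  fix n show "lev_fps X k q $ n = ?rhs $ n"
  proof (cases n)
    case 0
    then show ?thesis by simp
  next
    case (Suc l)
    let ?W = "words k (Suc l)"
    have card_outside: "card ({1..k} - X) = k - card X"
      using assms finite_subset[OF assms] by (simp add: card_Diff_subset)
    have outside: "{w \<in> ?W. hd w \<notin> X} = {w \<in> ?W. hd w \<in> {1..k} - X}"
      by (auto simp: words_def length_Suc_conv)
    have "lev_fps X k q $ n =
        (\<Sum>w | w \<in> ?W \<and> hd w \<notin> X. q ^ lev X w) + (\<Sum>w | w \<in> ?W \<and> hd w \<in> X. q ^ lev X w)"
      unfolding Suc lev_fps_def fps_nth_Abs_fps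
      by (subst sum.union_disjoint [symmetric]) (auto intro: sum.cong)
    also have "(\<Sum>w | w \<in> ?W \<and> hd w \<notin> X. q ^ lev X w)
        = (\<Sum>w\<in>words k l. \<Sum>c\<in>{1..k} - X. q ^ lev X (c # w))"
      unfolding outside by (rule sum_words_Suc_hd_in) simp
    also have "\<dots> = of_nat (k - card X) * lev_fps X k q $ l"
      by (simp add: lev_Cons card_outside lev_fps_def sum_distrib_left del: One_nat_def)
    finally show ?thesis by (simp add: Suc lev_hd_fps_nth_Suc)
  qed
qed

lemma one_minus_const_fps_X_mult_geometric:
  fixes y :: "'a :: comm_ring_1"
  shows "(1 - fps_const y * fps_X) * Abs_fps (\<lambda>j. y ^ j) = 1"
proof (rule fps_ext)
  fix j show "((1 - fps_const y * fps_X) * Abs_fps (\<lambda>j. y ^ j)) $ j = (1 :: 'a fps) $ j"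
    by (cases j) (simp_all add: left_diff_distrib mult.assoc)
qed

lemma geometric_fps_power_nth:
  fixes y :: "'a :: comm_ring_1"
  shows "(Abs_fps (\<lambda>j. y ^ j) ^ i) $ j = of_nat ((i + j - 1) choose j) * y ^ j"
proof (induction i arbitrary: j)
  case 0
  show ?case by (cases j) (simp_all add: binomial_eq_0)
next
  case (Suc i)
  have choose_sum: "(\<Sum>l\<le>j. (i + l - 1) choose l) = (i + j) choose j"
    by (induction j) simp_all
  have "(Abs_fps (\<lambda>j. y ^ j) ^ Suc i) $ j =
      (\<Sum>l\<le>j. of_nat ((i + l - 1) choose l) * y ^ l * y ^ (j - l))"
    by (simp only: power_Suc2 fps_mult_nth Suc.IH atMost_atLeast0 fps_nth_Abs_fps)
  also have "\<dots> = of_nat (\<Sum>l\<le>j. (i + l - 1) choose l) * y ^ j"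
    by (simp add: mult.assoc sum_distrib_right flip: power_add)
  also have "\<dots> = of_nat ((i + j) choose j) * y ^ j"
    by (simp only: choose_sum)
  finally show ?case by simp
qed

definition block_fps :: "nat \<Rightarrow> nat \<Rightarrow> 'a \<Rightarrow> 'a :: comm_ring_1 fps" where
  "block_fps a b y = of_nat a + of_nat b * Abs_fps (\<lambda>j. y ^ j)"

lemma block_fps_power_nth:
  "(block_fps a b y ^ m) $ j = (\<Sum>i\<le>m.
    of_nat ((m choose i) * ((i + j - 1) choose j) * a ^ (m - i) * b ^ i) * y ^ j)"
proof -
  let ?g = "Abs_fps (\<lambda>j. y ^ j)"
  have "block_fps a b y ^ m = (\<Sum>i\<le>m. of_nat ((m choose i) * b ^ i * a ^ (m - i)) * ?g ^ i)"
    unfolding block_fps_def add.commute[of "of_nat a"] binomial_ring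
    by (simp add: power_mult_distrib mult_ac)
  then have "(block_fps a b y ^ m) $ j = (\<Sum>i\<le>m. of_nat ((m choose i) * b ^ i * a ^ (m - i)) *
      (of_nat ((i + j - 1) choose j) * y ^ j))"
    by (simp only: fps_sum_nth fps_mult_of_nat_nth geometric_fps_power_nth)
  then show ?thesis
    by (simp add: mult_ac)
qed

lemma one_minus_fps_X_block_fps_mult_lev_fps:
  fixes q :: "'a :: comm_ring_1"
  assumes "X \<subseteq> {1..k}"
  shows "(1 - fps_X * block_fps (k - card X) (card X) (q - 1)) * lev_fps X k q = 1"
proof -
  let ?W = "lev_fps X k q" and ?H = "lev_hd_fps X k q"
  let ?a = "of_nat (k - card X) :: 'a fps" and ?b = "of_nat (card X) :: 'a fps"
  let ?y = "fps_const (q - 1)" and ?g = "Abs_fps (\<lambda>j. (q - 1) ^ j)"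
  have hd_equation: "(1 - ?y * fps_X) * ?H = fps_X * ?b * ?W"
    using lev_hd_fps_eq[OF assms, of q] by (simp add: algebra_simps)
  have "?H = (1 - ?y * fps_X) * ?g * ?H"
    by (simp only: one_minus_const_fps_X_mult_geometric mult_1)
  also have "\<dots> = ?g * ((1 - ?y * fps_X) * ?H)"
    by (simp only: mult_ac)
  also have "\<dots> = ?g * (fps_X * ?b * ?W)"
    by (simp only: hd_equation)
  also have "\<dots> = fps_X * (?b * ?g) * ?W"
    by (simp only: mult_ac)
  finally have "?W = 1 + fps_X * (?a * ?W) + fps_X * (?b * ?g) * ?W"
    using lev_fps_eq[OF assms, of q] by simp
  then show ?thesis
    by (simp add: block_fps_def algebra_simps)
qed

lemma fps_nth_eq_sum_power_nth:
  fixes f u :: "'a :: comm_ring_1 fps"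
  assumes "(1 - fps_X * u) * f = 1"
  shows "f $ n = (\<Sum>m\<le>n. (u ^ m) $ (n - m))"
proof -
  let ?z = "fps_X * u"
  have "f - ?z ^ Suc n * f = (1 - ?z ^ Suc n) * f"
    by (simp add: algebra_simps)
  also have "\<dots> = (1 - ?z) * f * (\<Sum>m<Suc n. ?z ^ m)"
    by (simp only: one_diff_power_eq mult_ac)
  finally have "f - ?z ^ Suc n * f = (\<Sum>m<Suc n. ?z ^ m)"
    using assms by simp
  then have "f = (\<Sum>m\<le>n. fps_X ^ m * u ^ m) + fps_X ^ Suc n * (u ^ Suc n * f)"
    by (simp only: lessThan_Suc_atMost power_mult_distrib mult.assoc diff_eq_eq)
  then have "f $ n = ((\<Sum>m\<le>n. fps_X ^ m * u ^ m) + fps_X ^ Suc n * (u ^ Suc n * f)) $ n"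
    by (rule arg_cong)
  then show ?thesis
    by (simp add: fps_sum_nth fps_X_power_mult_nth del: power_Suc)
qed

lemma coeff_lev_fps_nth:
  "coeff (lev_fps X k [:0, 1:] $ n) s = of_nat (card {w \<in> words k n. lev X w = s})"
proof -
  have "[:0, 1:] ^ j = monom (1 :: 'a) j" for j
    by (simp add: monom_altdef)
  then show ?thesis
    by (simp add: lev_fps_def coeff_sum Collect_conj_eq flip: of_bool_def)
qed

lemma coeff_X_minus_one_power:
  "coeff ([:- 1, 1:] ^ d) s = (- 1 :: 'a :: comm_ring_1) ^ (d + s) * of_nat (d choose s)"
proof (cases "s \<le> d")
  case True
  then show ?thesis
    by (simp add: coeff_linear_poly_power minus_one_power_iff)
next
  case False
  then show ?thesis by (simp add: coeff_eq_0 degree_linear_power binomial_eq_0)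
qed

lemma card_words_lev:
  assumes "X \<subseteq> {1..k}"
  shows "of_nat (card {w \<in> words k n. lev X w = s}) =
    (\<Sum>m\<le>n. \<Sum>i\<le>m. (- 1 :: 'a :: comm_ring_1) ^ (n - m + s) * of_nat ((m choose i) *
      ((i + (n - m) - 1) choose (n - m)) * ((n - m) choose s) * (k - card X) ^ (m - i) * card X ^ i))"
proof -
  have "lev_fps X k [:0, 1 :: 'a:] $ n =
      (\<Sum>m\<le>n. (block_fps (k - card X) (card X) [:- 1, 1:] ^ m) $ (n - m))"
    using fps_nth_eq_sum_power_nth
      [OF one_minus_fps_X_block_fps_mult_lev_fps[OF assms, of "[:0, 1 :: 'a:]"]]
    by (simp add: one_pCons)
  also have "\<dots> = (\<Sum>m\<le>n. \<Sum>i\<le>m. of_nat ((m choose i) * ((i + (n - m) - 1) choose (n - m)) *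
      (k - card X) ^ (m - i) * card X ^ i) * [:- 1, 1:] ^ (n - m))"
    by (simp only: block_fps_power_nth)
  finally have "of_nat (card {w \<in> words k n. lev X w = s}) =
      (\<Sum>m\<le>n. \<Sum>i\<le>m. of_nat ((m choose i) * ((i + (n - m) - 1) choose (n - m)) *
        (k - card X) ^ (m - i) * card X ^ i) * coeff ([:- 1, 1 :: 'a:] ^ (n - m)) s)"
    by (simp add: coeff_sum of_nat_poly flip: coeff_lev_fps_nth del: of_nat_mult of_nat_power)
  then show ?thesis
    by (simp add: coeff_X_minus_one_power mult_ac)
qed

text \<open>The subtraction on the right truncates only for \<open>i = j = 0\<close>, where both sides are 1.\<close>
lemma gbinomial_add_minus_one:
  "((of_nat i + of_nat j - 1) gchoose j :: 'a :: field_char_0) = of_nat ((i + j - 1) choose j)"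
proof (cases "i + j")
  case 0
  then show ?thesis by simp
next
  case (Suc l)
  then have "of_nat i + of_nat j - 1 = (of_nat l :: 'a)"
    by (simp flip: of_nat_add)
  then show ?thesis
    using Suc by (simp add: binomial_gbinomial)
qed

lemma minus_one_powi_diff: "(- 1 :: 'a :: field) powi (int d - int s) = (- 1) ^ (d + s)"
  by (simp add: power_int_diff power_add minus_one_power_iff)

theorem theorem3p1:
  fixes k t n s :: nat
  assumes "1 \<le> t" and "t \<le> k"
  shows "real (card {w \<in> words k n. lev {1..t} w = s}) =
    (\<Sum>m=0..n. \<Sum>i=0..m.
      (-1) powi (int n - int m - int s)
      * (real m gchoose i)
      * ((real i + real n - real m - 1) gchoose (n - m))
      * (real (n - m) gchoose s)
      * (real k - real t) ^ (m - i) * real t ^ i)"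
proof -
  have cast_diffs: "int n - int m = int (n - m)" "real i + real n - real m = real i + real (n - m)"
    if "m \<in> {0..n}" for m i
    using that by simp_all
  have "real k - real t = real (k - t)"
    using assms by simp
  moreover have "real (card {w \<in> words k n. lev {1..t} w = s}) =
    (\<Sum>m=0..n. \<Sum>i=0..m. (- 1) ^ (n - m + s) * real ((m choose i) *
      ((i + (n - m) - 1) choose (n - m)) * ((n - m) choose s) * (k - t) ^ (m - i) * t ^ i))"
    using card_words_lev[of "{1..t}" k] assms by (simp add: atMost_atLeast0)
  ultimately show ?thesis
    by (simp only: cast_diffs minus_one_powi_diff gbinomial_add_minus_one of_nat_mult of_nat_power
        mult.assoc flip: binomial_gbinomial cong: sum.cong)
qed

end
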